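(* Let $c:\mathbb{R}^n\times\mathbb{R}^m\to\mathbb{R}$ be a nonsmooth Lipschitz continuous function, with $c(\cdot,y)$ convex for every $y\in\mathbb{R}^m$ and $c(x,\cdot)$ concave for every $x\in\mathbb{R}^n$, and let $X\subset\mathbb{R}^n$, $Y\subset\mathbb{R}^m$ be convex and compact. Let $\psi_\varepsilon:\mathbb{R}^{n+m}\to[0,+\infty)$, $\varepsilon\in(0,1]$, be bounded, measurable functions satisfying $\int_{\mathbb{R}^{n+m}}\psi_\varepsilon(u)\,du=1$ and $\lim_{\varepsilon\downarrow0}B^\varepsilon=\{0\}$, where $B^\varepsilon:=\{u:\psi_\varepsilon(u)>0\}$. Let $\tilde c:\mathbb{R}^n\times\mathbb{R}^m\times(0,1]\to\mathbb{R}$ be defined by $$\tilde c(z,\varepsilon)=\int_{\mathbb{R}^{n+m}}c(z-u)\psi_\varepsilon(u)\,du,\qquad z=(x,y).$$ Then $\tilde c$ is a smoothing function of $c$ on $X\times Y$ and satisfies the following properties. (i) For any $\bar x\in X$ and $\bar y\in Y$, $$\Big\{\lim_{x\to\bar x,\,y\to\bar y,\,\varepsilon\downarrow0}\nabla_{(x,y)}\tilde c(x,y,\varepsilon)\Big\}\subseteq\partial c(\bar x,\bar y),$$ $$\Big\{\lim_{x\to\bar x,\,y\to\bar y,\,\varepsilon\downarrow0}\nabla_{x}\tilde c(x,y,\varepsilon)\Big\}\subseteq\partial_x c(\bar x,\bar y),\qquad \Big\{\lim_{x\to\bar x,\,y\to\bar y,\,\varepsilon\downarrow0}\nabla_{y}\tilde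 c(x,y,\varepsilon)\Big\}\subseteq\partial_y c(\bar x,\bar y).$$ (ii) For any $\varepsilon>0$ (in the domain $(0,1]$ of the smoothing parameter), $\tilde c(x,y,\varepsilon)$ is convex in $x\in\mathbb{R}^n$ and concave in $y\in\mathbb{R}^m$.
   Context: A function $\tilde c:X\times Y\times(0,1]\to\mathbb{R}$ is called a smoothing function of $c$ on $X\times Y$ if $\tilde c(\cdot,\cdot,\varepsilon)$ is continuously differentiable on $X\times Y$ for each fixed $\varepsilon\in(0,1]$ and, for any $(\bar x,\bar y)\in X\times Y$, $\lim_{x\to\bar x,\,y\to\bar y,\,\varepsilon\downarrow0}\tilde c(x,y,\varepsilon)=c(\bar x,\bar y)$. The limit $\lim_{\varepsilon\downarrow0}B^\varepsilon=\{0\}$ is a limit of sets in $\mathbb{R}^{n+m}$. In (i), each set in braces is the set of all limits of the indicated gradients along sequences $x^k\to\bar x$, $y^k\to\bar y$, $\varepsilon_k\downarrow0$ for which the limit exists. $\partial c$ is the Clarke subdifferential of $c$ in $(x,y)$; $\partial_x c(\bar x,\bar y)$ is the Clarke subdifferential of $x\mapsto c(x,\bar y)$ at $\bar x$, and $\partial_y c(\bar x,\bar y)$ is that of $y\mapsto c(\bar x,y)$ at $\bar y$. *)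

theory Defs
  imports "HOL-Analysis.Analysis"
begin

text \<open>The pair type \<open>'a \<times> 'b\<close> carries the Euclidean norm, inner product and Lebesgue measure of the
  product, so \<open>(real ^ 'n) \<times> (real ^ 'm)\<close> plays the role of the Euclidean space of dimension $n+m$.\<close>

definition gradient :: "('a::real_inner \<Rightarrow> real) \<Rightarrow> 'a \<Rightarrow> 'a" where
  "gradient f x = (THE D. GDERIV f x :> D)"

text \<open>Continuous differentiability on a set that need not be open (it may even have empty interior)
  is understood, as usual, on some open neighbourhood of the set.\<close>

definition cont_diff_on :: "'a::real_inner set \<Rightarrow> ('a \<Rightarrow> real) \<Rightarrow> bool" where
  "cont_diff_on S f \<longleftrightarrow>
     (\<exists>U g. open U \<and> S \<subseteq> U \<and> (\<forall>z\<in>U. GDERIV f z :> g z) \<and> continuous_on U g)"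

text \<open>The limit is taken inside the domain \<open>X \<times> Y \<times> (0,1]\<close>; as \<open>((x, y), 0)\<close> is not in the
  domain, the points \<open>((x, y), \<epsilon>)\<close> with \<open>\<epsilon> \<down> 0\<close> are not excluded by the punctured filter.\<close>

definition smoothing_function ::
  "'a::euclidean_space set \<Rightarrow> 'b::euclidean_space set \<Rightarrow> ('a \<times> 'b \<Rightarrow> real)
     \<Rightarrow> ('a \<times> 'b \<Rightarrow> real \<Rightarrow> real) \<Rightarrow> bool" where
  "smoothing_function X Y c ct \<longleftrightarrow>
     (\<forall>\<epsilon>\<in>{0<..1}. cont_diff_on (X \<times> Y) (\<lambda>z. ct z \<epsilon>)) \<and>
     (\<forall>x\<in>X. \<forall>y\<in>Y.
        ((\<lambda>(z, \<epsilon>). ct z \<epsilon>) \<longlongrightarrow> c (x, y)) (at ((x, y), 0) within (X \<times> Y) \<times> {0<..1}))"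

text \<open>Convergence of sets in the Hausdorff sense. (Painleve--Kuratowski convergence would be too weak
  for averaged functions: it ignores parts of the supports that escape to infinity.)\<close>

definition hausdorff_tendsto ::
  "('i \<Rightarrow> 'a::metric_space set) \<Rightarrow> 'a set \<Rightarrow> 'i filter \<Rightarrow> bool" where
  "hausdorff_tendsto A S F \<longleftrightarrow>
     (\<forall>\<delta>>0. eventually (\<lambda>i. A i \<subseteq> (\<Union>s\<in>S. ball s \<delta>) \<and> S \<subseteq> (\<Union>a\<in>A i. ball a \<delta>)) F)"

definition averaged ::
  "('a::euclidean_space \<Rightarrow> real) \<Rightarrow> (real \<Rightarrow> 'a \<Rightarrow> real) \<Rightarrow> 'a \<Rightarrow> real \<Rightarrow> real" where
  "averaged c \<psi> z \<epsilon> = (LINT u|lebesgue. c (z - u) * \<psi> \<epsilon> u)"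

text \<open>Clarke's generalized directional derivative
  $f^\circ(x;v) = \limsup_{y \to x,\, t \downarrow 0} (f(y+tv)-f(y))/t$; here \<open>y = x\<close> is allowed.\<close>

definition clarke_deriv :: "('a::real_inner \<Rightarrow> real) \<Rightarrow> 'a \<Rightarrow> 'a \<Rightarrow> ereal" where
  "clarke_deriv f x v =
     Limsup (nhds x \<times>\<^sub>F at_right 0) (\<lambda>(y, t). ereal ((f (y + t *\<^sub>R v) - f y) / t))"

definition clarke_subdiff :: "('a::real_inner \<Rightarrow> real) \<Rightarrow> 'a \<Rightarrow> 'a set" where
  "clarke_subdiff f x = {\<xi>. \<forall>v. ereal (\<xi> \<bullet> v) \<le> clarke_deriv f x v}"

text \<open>All limits of \<open>G (x\<^sub>k, y\<^sub>k) \<epsilon>\<^sub>k\<close> along sequences in the full space (not only in \<open>X \<times> Y\<close>).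
  Monotonicity of \<open>\<epsilon>\<^sub>k\<close> need not be imposed: every positive null sequence has a strictly
  decreasing subsequence.\<close>

definition sequential_limits ::
  "('a::topological_space \<times> 'b::topological_space \<Rightarrow> real \<Rightarrow> 'c::topological_space)
     \<Rightarrow> 'a \<Rightarrow> 'b \<Rightarrow> 'c set" where
  "sequential_limits G x y =
     {v. \<exists>xs ys es. xs \<longlonglongrightarrow> x \<and> ys \<longlonglongrightarrow> y \<and> (\<forall>k. es k \<in> {0<..1}) \<and> es \<longlonglongrightarrow> 0 \<and>
           (\<lambda>k::nat. G (xs k, ys k) (es k)) \<longlonglongrightarrow> v}"

end

theory Submission
  imports Defs
begin

text \<open>The function \<open>averaged c \<psi> z \<epsilon>\<close> is the mean of \<open>c (z - u)\<close> over the probability measure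
  with density \<open>\<psi> \<epsilon>\<close>. Convexity in \<open>x\<close> and concavity in \<open>y\<close> are inherited by averages,
  and as the measures concentrate at the origin, the Lipschitz condition makes the averages converge
  to \<open>c\<close> jointly in the point and the parameter (\<open>convolve_tendsto\<close>).

  Smoothness rests on convexity along the coordinate axes instead of Rademacher's theorem. Along an
  axis \<open>c\<close> is convex or concave; in the convex case it has a left and a right derivative
  everywhere, and these agree almost everywhere (\<open>AE_slopes_eq\<close>). Where they agree, the
  right derivative is continuous, jointly in all variables, because it is upper semicontinuous and
  the left derivative is lower semicontinuous. By dominated convergence the average of the right
  derivative is then continuous everywhere. Integrating the subgradient inequality identifies it as
  the partial derivative of the average (\<open>convolve_has_slope\<close>), and continuous partial
  derivatives give continuous differentiability (\<open>convolve_C1\<close>). If \<open>c (z - u)\<close> is not integrable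
  for one \<open>z\<close>, it is integrable for none; the average is then the zero function by
  the convention for the integral, and all regularity claims hold trivially.

  For the full gradient, a directional derivative of the average is a limit of averages of
  difference quotients of \<open>c\<close> at nearby points, so it is bounded by any local bound on these
  quotients; Clarke's directional derivative is the infimum of such bounds
  (\<open>gradient_limit_clarke\<close>). For the partial gradients this argument would only lead to the Clarke
  subdifferential of \<open>c\<close> as a function of both variables. The tangent inequality for convex
  functions is used instead: it passes to the limit by joint convergence and shows that a limit is a
  subgradient (in \<open>x\<close>) or a supergradient (in \<open>y\<close>) of the limiting slice, hence a Clarke
  subgradient (\<open>clarke_subdiff_convex\<close>, \<open>clarke_subdiff_concave\<close>).\<close>

section \<open>Gradients of functions on Euclidean spaces\<close>

lemma gradient_eq:
  assumes "GDERIV f x :> D"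
  shows "gradient f x = D"
  unfolding gradient_def
proof (rule the_equality)
  fix D' assume "GDERIV f x :> D'"
  then have "(\<lambda>h. h \<bullet> D') = (\<lambda>h. h \<bullet> D)"
    using assms unfolding gderiv_def by (rule has_derivative_unique)
  then show "D' = D" by (metis vector_eq_ldot)
qed (fact assms)

lemma GDERIV_fst:
  fixes f :: "'a::real_inner \<times> 'b::real_inner \<Rightarrow> real"
  assumes "GDERIV f (x, y) :> D"
  shows "GDERIV (\<lambda>x. f (x, y)) x :> fst D"
proof -
  have "((\<lambda>x. (x, y)) has_derivative (\<lambda>h. (h, 0))) (at x)"
    by (intro has_derivative_Pair has_derivative_ident has_derivative_const)
  from has_derivative_compose[OF this assms[unfolded gderiv_def]]
  show ?thesis by (simp add: gderiv_def inner_prod_def)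
qed

lemma GDERIV_snd:
  fixes f :: "'a::real_inner \<times> 'b::real_inner \<Rightarrow> real"
  assumes "GDERIV f (x, y) :> D"
  shows "GDERIV (\<lambda>y. f (x, y)) y :> snd D"
proof -
  have "((\<lambda>y. (x, y)) has_derivative (\<lambda>h. (0, h))) (at y)"
    by (intro has_derivative_Pair has_derivative_ident has_derivative_const)
  from has_derivative_compose[OF this assms[unfolded gderiv_def]]
  show ?thesis by (simp add: gderiv_def inner_prod_def)
qed

lemma GDERIV_line:
  assumes "GDERIV f x :> D"
  shows "((\<lambda>t. f (x + t *\<^sub>R h)) has_real_derivative D \<bullet> h) (at 0)"
proof -
  have inner: "((\<lambda>t. x + t *\<^sub>R h) has_derivative (\<lambda>t. t *\<^sub>R h)) (at 0)"
    by (auto intro!: derivative_eq_intros)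
  have "(f has_derivative (\<lambda>v. v \<bullet> D)) (at (x + 0 *\<^sub>R h))"
    using assms by (simp add: gderiv_def)
  from has_derivative_compose[OF inner this]
  have "((\<lambda>t. f (x + t *\<^sub>R h)) has_derivative (\<lambda>t. (t *\<^sub>R h) \<bullet> D)) (at 0)" .
  moreover have "(\<lambda>t. (t *\<^sub>R h) \<bullet> D) = (*) (D \<bullet> h)"
    by (rule ext) (simp add: inner_commute[of h D])
  ultimately show ?thesis by (simp add: has_field_derivative_def)
qed

lemma convex_on_compose_affine:
  assumes cvx: "convex_on UNIV f" and "linear l"
  shows "convex_on UNIV (\<lambda>t. f (a + l t))"
  unfolding convex_on_def
proof (intro conjI ballI allI impI)
  interpret l: linear l by fact
  fix s t and p q :: real assume pq: "0 \<le> p" "0 \<le> q" "p + q = 1"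
  have "a + l (p *\<^sub>R s + q *\<^sub>R t) = (p + q) *\<^sub>R a + l (p *\<^sub>R s + q *\<^sub>R t)" using pq by simp
  also have "\<dots> = p *\<^sub>R (a + l s) + q *\<^sub>R (a + l t)"
    unfolding l.add l.scale by (simp add: algebra_simps)
  finally show "f (a + l (p *\<^sub>R s + q *\<^sub>R t)) \<le> p * f (a + l s) + q * f (a + l t)"
    using cvx pq unfolding convex_on_def by simp
qed simp

text \<open>This restricts the claim to the line through \<open>x\<close> in direction \<open>h\<close>, where it is the tangent
  inequality for convex functions of one real variable.\<close>

lemma convex_on_above_gradient:
  assumes cvx: "convex_on UNIV f" and deriv: "GDERIV f x :> D"
  shows "D \<bullet> h \<le> f (x + h) - f x"
proof -
  have "convex_on UNIV (\<lambda>t. f (x + t *\<^sub>R h))"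
    using cvx by (rule convex_on_compose_affine) (auto intro!: linearI simp: algebra_simps)
  from convex_on_imp_above_tangent[OF this, of 0 1 "D \<bullet> h"] show ?thesis
    using GDERIV_line[OF deriv] by simp
qed

text \<open>The increment along \<open>h\<close> is split into \<open>DIM('a)\<close> increments along the axes. Each of them is
  controlled by the mean value theorem, uniformly over nearby base points because the partial
  derivative is continuous; the induction over subsets of the basis adds these estimates up.\<close>

lemma GDERIV_from_continuous_partials:
  fixes f :: "'a::euclidean_space \<Rightarrow> real"
  assumes deriv: "\<And>b w. b \<in> Basis \<Longrightarrow> ((\<lambda>t. f (w + t *\<^sub>R b)) has_real_derivative G b w) (at 0)"
    and cont: "\<And>b. b \<in> Basis \<Longrightarrow> continuous_on UNIV (G b)"
  shows "GDERIV f z :> (\<Sum>b\<in>Basis. G b z *\<^sub>R b)"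
proof -
  have line: "\<exists>d>0. \<forall>w t. norm (w - z) < d \<longrightarrow> \<bar>t\<bar> < d \<longrightarrow>
      \<bar>f (w + t *\<^sub>R b) - f w - t * G b z\<bar> \<le> e * \<bar>t\<bar>" if b: "b \<in> Basis" and e: "e > 0" for b e
  proof -
    obtain d where d: "d > 0" "\<forall>w. dist w z < d \<longrightarrow> dist (G b w) (G b z) < e"
      using cont[OF b, unfolded continuous_on_iff] e by blast
    have "\<bar>f (w + t *\<^sub>R b) - f w - t * G b z\<bar> \<le> e * \<bar>t\<bar>"
      if w: "norm (w - z) < d / 2" and t: "\<bar>t\<bar> < d / 2" for w t
    proof -
      have "norm ((f (w + t *\<^sub>R b) - t * G b z) - (f (w + 0 *\<^sub>R b) - 0 * G b z)) \<le> e * norm (t - 0)"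
      proof (rule field_differentiable_bound[where S = "closed_segment 0 t"
            and f' = "\<lambda>s. G b (w + s *\<^sub>R b) - G b z"])
        fix s assume s: "s \<in> closed_segment 0 t"
        have "w + s *\<^sub>R b + r *\<^sub>R b = w + (r + s) *\<^sub>R b" for r
          by (simp add: scaleR_left_distrib)
        then have "((\<lambda>r. f (w + (r + s) *\<^sub>R b)) has_real_derivative G b (w + s *\<^sub>R b)) (at 0)"
          using deriv[OF b, of "w + s *\<^sub>R b"] by (simp only:)
        then have "((\<lambda>r. f (w + r *\<^sub>R b)) has_real_derivative G b (w + s *\<^sub>R b)) (at s)"
          using DERIV_shift[of "\<lambda>r. f (w + r *\<^sub>R b)" _ 0 s] by simp
        moreover have "((\<lambda>r. r * G b z) has_real_derivative G b z) (at s)"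
          using DERIV_cmult_right[OF DERIV_ident, of "G b z"] by simp
        ultimately show "((\<lambda>r. f (w + r *\<^sub>R b) - r * G b z) has_field_derivative G b (w + s *\<^sub>R b) - G b z)
            (at s within closed_segment 0 t)"
          by (rule has_field_derivative_at_within[OF DERIV_diff])
        have "\<bar>s\<bar> \<le> \<bar>t\<bar>" using s by (auto simp: closed_segment_eq_real_ivl split: if_splits)
        then have "norm (w - z + s *\<^sub>R b) < d"
          using norm_triangle_ineq[of "w - z" "s *\<^sub>R b"] w t b by simp
        then have "dist (w + s *\<^sub>R b) z < d" by (simp add: dist_norm add_diff_eq diff_add_eq)
        with d(2) show "norm (G b (w + s *\<^sub>R b) - G b z) \<le> e"
          by (simp add: dist_real_def less_imp_le)
      qed auto
      then show ?thesis by simp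
    qed
    then show ?thesis using d(1) by (intro exI[of _ "d / 2"]) auto
  qed
  have "\<forall>e>0. \<exists>d>0. \<forall>h. norm h < d \<longrightarrow>
      \<bar>f (z + (\<Sum>b\<in>S. (h \<bullet> b) *\<^sub>R b)) - f z - (\<Sum>b\<in>S. (h \<bullet> b) * G b z)\<bar> \<le> e * norm h"
    if S: "S \<subseteq> Basis" for S
    using finite_subset[OF S finite_Basis] S
  proof (induction S rule: finite_induct)
    case empty
    then show ?case by (auto intro: exI[of _ 1])
  next
    case (insert b S)
    show ?case
    proof (intro allI impI)
      fix e :: real assume e: "e > 0"
      obtain d1 where d1: "d1 > 0" "\<And>h. norm h < d1 \<Longrightarrow>
         \<bar>f (z + (\<Sum>b\<in>S. (h \<bullet> b) *\<^sub>R b)) - f z - (\<Sum>b\<in>S. (h \<bullet> b) * G b z)\<bar> \<le> e / 2 * norm h"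
        using insert e by (meson half_gt_zero insert_subset)
      obtain d2 where d2: "d2 > 0" "\<And>w t. norm (w - z) < d2 \<Longrightarrow> \<bar>t\<bar> < d2 \<Longrightarrow>
         \<bar>f (w + t *\<^sub>R b) - f w - t * G b z\<bar> \<le> e / 2 * \<bar>t\<bar>"
        using line[of b "e / 2"] insert e by (meson half_gt_zero insert_subset)
      \<comment> \<open>A partial sum of the components of \<open>h\<close> has norm at most \<open>card S * norm h\<close>.\<close>
      define m where "m = real (card S) + 1"
      have m: "m \<ge> 1" by (simp add: m_def)
      have "\<bar>f (z + (\<Sum>b\<in>insert b S. (h \<bullet> b) *\<^sub>R b)) - f z - (\<Sum>b\<in>insert b S. (h \<bullet> b) * G b z)\<bar>
          \<le> e * norm h" if h: "norm h < min d1 (d2 / m)" for h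
      proof -
        let ?w = "z + (\<Sum>b\<in>S. (h \<bullet> b) *\<^sub>R b)"
        have hb: "\<bar>h \<bullet> b\<bar> \<le> norm h" if "b \<in> Basis" for b :: 'a
          using that by (rule Basis_le_norm)
        have "norm h * m < d2" using h m by (simp add: less_divide_eq)
        moreover have "norm h * 1 \<le> norm h * m" using m by (intro mult_left_mono) auto
        ultimately have hd: "norm h < d2" by simp
        have "norm (\<Sum>b\<in>S. (h \<bullet> b) *\<^sub>R b) \<le> (\<Sum>b\<in>S. norm h)"
        proof (rule sum_norm_le)
          fix b assume "b \<in> S"
          then have "b \<in> Basis" using insert.prems by auto
          then show "norm ((h \<bullet> b) *\<^sub>R b) \<le> norm h" using hb by simp
        qed
        also have "\<dots> \<le> norm h * m" by (simp add: m_def algebra_simps)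
        finally have wd: "norm (?w - z) < d2" using \<open>norm h * m < d2\<close> by simp
        have td: "\<bar>h \<bullet> b\<bar> < d2" using hb[of b] hd insert.prems by simp
        have le: "e / 2 * \<bar>h \<bullet> b\<bar> \<le> e / 2 * norm h"
          using hb[of b] e insert.prems by (intro mult_left_mono) auto
        have arg: "z + (\<Sum>b\<in>insert b S. (h \<bullet> b) *\<^sub>R b) = ?w + (h \<bullet> b) *\<^sub>R b"
          using insert by (simp add: algebra_simps)
        have lin: "(\<Sum>b\<in>insert b S. (h \<bullet> b) * G b z) = (h \<bullet> b) * G b z + (\<Sum>b\<in>S. (h \<bullet> b) * G b z)"
          using insert by simp
        have "norm h < d1" using h by simp
        from d1(2)[OF this] d2(2)[OF wd td] le show ?thesis
          unfolding arg lin by linarith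
      qed
      moreover have "min d1 (d2 / m) > 0" using d1 d2 m by simp
      ultimately show "\<exists>d>0. \<forall>h. norm h < d \<longrightarrow>
          \<bar>f (z + (\<Sum>b\<in>insert b S. (h \<bullet> b) *\<^sub>R b)) - f z - (\<Sum>b\<in>insert b S. (h \<bullet> b) * G b z)\<bar> \<le> e * norm h"
        by blast
    qed
  qed
  from this[OF order_refl] have est: "\<forall>e>0. \<exists>d>0. \<forall>h. norm h < d \<longrightarrow>
      \<bar>f (z + h) - f z - (\<Sum>b\<in>Basis. (h \<bullet> b) * G b z)\<bar> \<le> e * norm h"
    by (simp add: euclidean_representation)
  have lin: "h \<bullet> (\<Sum>b\<in>Basis. G b z *\<^sub>R b) = (\<Sum>b\<in>Basis. (h \<bullet> b) * G b z)" for h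
    by (simp add: inner_sum_right mult.commute)
  show ?thesis
    unfolding gderiv_def has_derivative_at_alt
  proof (intro conjI allI impI)
    show "bounded_linear (\<lambda>h. h \<bullet> (\<Sum>b\<in>Basis. G b z *\<^sub>R b))" by (rule bounded_linear_inner_left)
    fix e :: real assume "e > 0"
    then obtain d where d: "d > 0" "\<And>h. norm h < d \<Longrightarrow>
        \<bar>f (z + h) - f z - (\<Sum>b\<in>Basis. (h \<bullet> b) * G b z)\<bar> \<le> e * norm h"
      using est by blast
    have "norm (f y - f z - (y - z) \<bullet> (\<Sum>b\<in>Basis. G b z *\<^sub>R b)) \<le> e * norm (y - z)"
      if "norm (y - z) < d" for y
      unfolding lin using d(2)[OF that] by simp
    then show "\<exists>d>0. \<forall>y. norm (y - z) < d \<longrightarrow>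
        norm (f y - f z - (y - z) \<bullet> (\<Sum>b\<in>Basis. G b z *\<^sub>R b)) \<le> e * norm (y - z)"
      using d(1) by blast
  qed
qed

section \<open>One-sided slopes along a line of convexity\<close>

text \<open>For a function that is convex along \<open>e\<close>, difference quotients are monotone in the step, so that
  the infimum and the supremum below are the right and the left derivative along \<open>e\<close>. Taking them as
  an infimum and a supremum, and not as limits, yields semicontinuity, hence measurability, at
  once.\<close>

definition upper_slope :: "('a::real_vector \<Rightarrow> real) \<Rightarrow> 'a \<Rightarrow> 'a \<Rightarrow> real" where
  "upper_slope c e w = (INF t\<in>{0<..}. (c (w + t *\<^sub>R e) - c w) / t)"

definition lower_slope :: "('a::real_vector \<Rightarrow> real) \<Rightarrow> 'a \<Rightarrow> 'a \<Rightarrow> real" where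
  "lower_slope c e w = (SUP t\<in>{0<..}. (c w - c (w - t *\<^sub>R e)) / t)"

locale convex_direction =
  fixes c :: "'a::euclidean_space \<Rightarrow> real" and L :: real and e :: 'a
  assumes lip: "L-lipschitz_on UNIV c"
    and cvx: "\<And>w. convex_on UNIV (\<lambda>t. c (w + t *\<^sub>R e))"
begin

lemma diff_le: "\<bar>c v - c w\<bar> \<le> L * norm (v - w)"
  using lipschitz_onD[OF lip, of v w] by (simp add: dist_norm)

lemma continuous_function: "continuous_on UNIV c"
  using lip by (rule lipschitz_on_continuous_on)

lemma quotient_bound:
  assumes "t \<noteq> 0"
  shows "\<bar>(c (w + t *\<^sub>R e) - c w) / t\<bar> \<le> L * norm e"
  using diff_le[of "w + t *\<^sub>R e" w] assms by (simp add: abs_divide divide_simps mult_ac)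

lemma quotient_bound':
  assumes "t \<noteq> 0"
  shows "\<bar>(c w - c (w - t *\<^sub>R e)) / t\<bar> \<le> L * norm e"
  using diff_le[of w "w - t *\<^sub>R e"] assms by (simp add: abs_divide divide_simps mult_ac)

lemma quotient_ge: "t > 0 \<Longrightarrow> - (L * norm e) \<le> (c (w + t *\<^sub>R e) - c w) / t"
  using quotient_bound[of t w] by linarith

lemma quotient_le': "t > 0 \<Longrightarrow> (c w - c (w - t *\<^sub>R e)) / t \<le> L * norm e"
  using quotient_bound'[of t w] by linarith

text \<open>The point \<open>w\<close> is the convex combination of \<open>w - s e\<close> and \<open>w + t e\<close> with weights
  \<open>t / (s + t)\<close> and \<open>s / (s + t)\<close>.\<close>

lemma quotients_ordered:
  assumes s: "s > 0" and t: "t > 0"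
  shows "(c w - c (w - s *\<^sub>R e)) / s \<le> (c (w + t *\<^sub>R e) - c w) / t"
proof -
  define p where "p = s / (s + t)"
  have p: "0 \<le> p" "p \<le> 1" "(1 - p) * s = p * t" "(1 - p) * (s + t) = t" "p * (s + t) = s"
    using s t by (auto simp: p_def field_simps)
  have "c (w + ((1 - p) * - s + p * t) *\<^sub>R e)
      \<le> (1 - p) * c (w + (- s) *\<^sub>R e) + p * c (w + t *\<^sub>R e)"
    using convex_onD[OF cvx[of w], of p "-s" t] p by simp
  then have "c w \<le> (1 - p) * c (w - s *\<^sub>R e) + p * c (w + t *\<^sub>R e)"
    using p(3) by simp
  then have "(s + t) * c w \<le> (s + t) * ((1 - p) * c (w - s *\<^sub>R e) + p * c (w + t *\<^sub>R e))"
    using s t by (intro mult_left_mono) auto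
  also have "\<dots> = ((1 - p) * (s + t)) * c (w - s *\<^sub>R e) + (p * (s + t)) * c (w + t *\<^sub>R e)"
    by (simp add: algebra_simps)
  finally have "(s + t) * c w \<le> t * c (w - s *\<^sub>R e) + s * c (w + t *\<^sub>R e)"
    by (simp only: p(4,5))
  moreover have "(m - a) / s \<le> (b - m) / t" if "(s + t) * m \<le> t * a + s * b" for a b m
    using s t that by (simp add: divide_le_eq le_divide_eq) (simp add: algebra_simps)
  ultimately show ?thesis by blast
qed

lemma bdd_below_quotients: "bdd_below ((\<lambda>t. (c (w + t *\<^sub>R e) - c w) / t) ` {0<..})"
  by (rule bdd_belowI2[of _ "- (L * norm e)"]) (use quotient_ge[of _ w] in auto)

lemma bdd_above_quotients: "bdd_above ((\<lambda>t. (c w - c (w - t *\<^sub>R e)) / t) ` {0<..})"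
  by (rule bdd_aboveI2[of _ _ "L * norm e"]) (use quotient_le'[of _ w] in auto)

lemma upper_slope_le:
  assumes "t > 0"
  shows "upper_slope c e w \<le> (c (w + t *\<^sub>R e) - c w) / t"
  unfolding upper_slope_def using assms by (intro cINF_lower bdd_below_quotients) auto

lemma lower_slope_ge:
  assumes "t > 0"
  shows "(c w - c (w - t *\<^sub>R e)) / t \<le> lower_slope c e w"
  unfolding lower_slope_def using assms by (intro cSUP_upper bdd_above_quotients) auto

lemma lower_le_upper: "lower_slope c e w \<le> upper_slope c e w"
  unfolding lower_slope_def upper_slope_def
  by (intro cSUP_least cINF_greatest quotients_ordered) auto

text \<open>Both slopes are compared with the quotient over the segment from \<open>w\<close> to \<open>w + t e\<close>, which is
  a forward quotient at its start and a backward quotient at its end.\<close>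

lemma upper_le_lower_ahead:
  assumes "t > 0"
  shows "upper_slope c e w \<le> lower_slope c e (w + t *\<^sub>R e)"
  using upper_slope_le[OF assms, of w] lower_slope_ge[OF assms, of "w + t *\<^sub>R e"] by simp

lemma upper_slope_bound: "\<bar>upper_slope c e w\<bar> \<le> L * norm e"
proof (rule abs_leI)
  show "upper_slope c e w \<le> L * norm e"
    using upper_slope_le[of 1 w] quotient_bound[of 1 w] by simp
  have "- (L * norm e) \<le> upper_slope c e w" unfolding upper_slope_def
    by (intro cINF_greatest) (use quotient_ge[of _ w] in auto)
  then show "- upper_slope c e w \<le> L * norm e" by simp
qed

lemma lower_slope_bound: "\<bar>lower_slope c e w\<bar> \<le> L * norm e"
proof (rule abs_leI)
  show "lower_slope c e w \<le> L * norm e"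
    using lower_le_upper[of w] upper_slope_bound[of w] by simp
  show "- lower_slope c e w \<le> L * norm e"
    using lower_slope_ge[of 1 w] quotient_bound'[of 1 w] by simp
qed

lemma upper_slope_subgradient: "t * upper_slope c e w \<le> c (w + t *\<^sub>R e) - c w"
proof (cases "t \<ge> 0")
  case True
  then show ?thesis using upper_slope_le[of t w] by (cases "t = 0") (auto simp: field_simps)
next
  case False
  then have "(c w - c (w - (-t) *\<^sub>R e)) / (-t) \<le> upper_slope c e w"
    using lower_slope_ge[of "-t" w] lower_le_upper[of w] by linarith
  then show ?thesis using False by (simp add: field_simps)
qed

lemma open_upper_slope_less: "open {w. upper_slope c e w < a}"
proof -
  have "{w. upper_slope c e w < a} = (\<Union>t\<in>{0<..}. {w. (c (w + t *\<^sub>R e) - c w) / t < a})"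
    unfolding upper_slope_def using cINF_less_iff[OF _ bdd_below_quotients] by auto
  moreover have "open {w. (c (w + t *\<^sub>R e) - c w) / t < a}" if "t > 0" for t
    using that by (intro open_Collect_less continuous_intros continuous_on_subset[OF continuous_function]
      continuous_on_compose2[OF continuous_function]) auto
  ultimately show ?thesis by auto
qed

lemma open_lower_slope_greater: "open {w. a < lower_slope c e w}"
proof -
  have "{w. a < lower_slope c e w} = (\<Union>t\<in>{0<..}. {w. a < (c w - c (w - t *\<^sub>R e)) / t})"
    unfolding lower_slope_def using less_cSUP_iff[OF _ bdd_above_quotients] by auto
  moreover have "open {w. a < (c w - c (w - t *\<^sub>R e)) / t}" if "t > 0" for t
    using that by (intro open_Collect_less continuous_intros continuous_on_subset[OF continuous_function]
      continuous_on_compose2[OF continuous_function]) auto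
  ultimately show ?thesis by auto
qed

lemma upper_slope_measurable: "upper_slope c e \<in> borel_measurable borel"
  by (rule borel_measurableI_less) (use open_upper_slope_less in auto)

lemma lower_slope_measurable: "lower_slope c e \<in> borel_measurable borel"
  by (rule borel_measurableI_greater) (use open_lower_slope_greater in auto)

text \<open>The upper slope is upper semicontinuous and dominates the lower slope, which is lower
  semicontinuous; where the two agree, the upper slope is squeezed.\<close>

lemma isCont_upper_slope:
  assumes eq: "lower_slope c e w = upper_slope c e w"
  shows "isCont (upper_slope c e) w"
  unfolding continuous_within
proof (rule order_tendstoI)
  fix a assume "a < upper_slope c e w"
  then have "eventually (\<lambda>v. a < lower_slope c e v) (at w)"
    using open_lower_slope_greater[of a] eq
    by (intro eventually_at_in_open'[where A = "{v. a < lower_slope c e v}", simplified]) auto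
  then show "eventually (\<lambda>v. a < upper_slope c e v) (at w)"
    by eventually_elim (use lower_le_upper in \<open>auto intro: less_le_trans\<close>)
next
  fix a assume "upper_slope c e w < a"
  then show "eventually (\<lambda>v. upper_slope c e v < a) (at w)"
    using open_upper_slope_less[of a]
    by (intro eventually_at_in_open'[where A = "{v. upper_slope c e v < a}", simplified]) auto
qed

text \<open>The gap between the two slopes is the jump of a monotone function of the position on the line, and
  the jumps of a monotone function add up to at most its total variation. The bound does not
  depend on \<open>N\<close>.\<close>

lemma sum_gaps_le:
  fixes N :: nat
  assumes "N > 0"
  shows "(\<Sum>j<N. upper_slope c e (w + (j / N) *\<^sub>R e) - lower_slope c e (w + (j / N) *\<^sub>R e))
         \<le> 2 * (L * norm e)"
proof -
  let ?l = "\<lambda>j::nat. lower_slope c e (w + (j / N) *\<^sub>R e)"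
  have "upper_slope c e (w + (j / N) *\<^sub>R e) - ?l j \<le> ?l (Suc j) - ?l j" for j :: nat
    using upper_le_lower_ahead[of "1 / N" "w + (j / N) *\<^sub>R e"] assms
    by (simp add: scaleR_left_distrib add_divide_distrib ac_simps)
  then have "(\<Sum>j<N. upper_slope c e (w + (j / N) *\<^sub>R e) - ?l j) \<le> (\<Sum>j<N. ?l (Suc j) - ?l j)"
    by (rule sum_mono)
  also have "\<dots> = ?l N - ?l 0"
    by (rule sum_lessThan_telescope)
  also have "\<dots> \<le> 2 * (L * norm e)"
    using lower_slope_bound[of "w + (N / N) *\<^sub>R e"] lower_slope_bound[of "w + (real 0 / N) *\<^sub>R e"]
    unfolding abs_le_iff by linarith
  finally show ?thesis .
qed

text \<open>On each line the slopes differ in at most countably many points, and Fubini's theorem would give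
  the claim for an axis direction. Translation invariance gives it for every direction without
  choosing coordinates: \<open>N\<close> translates of the gap, by \<open>(j / N) e\<close> with \<open>j < N\<close>, have a sum
  that is bounded independently of \<open>N\<close>, while each of them has an integral, over a
  ball enlarged by \<open>norm e\<close>, at least that of the gap over the ball. So \<open>N\<close> times this last
  integral stays bounded, and the integral vanishes.\<close>

lemma AE_slopes_eq: "AE w in lborel. lower_slope c e w = upper_slope c e w"
proof -
  define d where "d w = ennreal (upper_slope c e w - lower_slope c e w)" for w
  have [measurable]: "d \<in> borel_measurable borel"
    unfolding d_def using upper_slope_measurable lower_slope_measurable by measurable
  define K where "K = ennreal (2 * (L * norm e))"
  have "(\<integral>\<^sup>+w. d w * indicator (ball 0 r) w \<partial>lborel) = 0" for r :: real
  proof -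
    define I where "I = (\<integral>\<^sup>+w. d w * indicator (ball 0 r) w \<partial>lborel)"
    define B where "B = ball (0::'a) (r + norm e)"
    have shift: "I \<le> (\<integral>\<^sup>+w. d (w + s *\<^sub>R e) * indicator B w \<partial>lborel)" if s: "0 \<le> s" "s \<le> 1" for s
    proof -
      have "I = (\<integral>\<^sup>+w. d w * indicator (ball 0 r) w \<partial>distr lborel borel ((+) (s *\<^sub>R e)))"
        by (simp add: I_def lborel_distr_plus)
      also have "\<dots> = (\<integral>\<^sup>+w. d (s *\<^sub>R e + w) * indicator (ball 0 r) (s *\<^sub>R e + w) \<partial>lborel)"
        by (subst nn_integral_distr) (auto intro!: borel_measurable_times_ennreal borel_measurable_indicator)
      also have "\<dots> \<le> (\<integral>\<^sup>+w. d (w + s *\<^sub>R e) * indicator B w \<partial>lborel)"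
      proof (rule nn_integral_mono)
        fix w :: 'a
        have "norm w \<le> norm (s *\<^sub>R e + w) + norm (s *\<^sub>R e)"
          using norm_triangle_ineq4[of "s *\<^sub>R e + w" "s *\<^sub>R e"] by simp
        moreover have "norm (s *\<^sub>R e) \<le> norm e"
          using s by (simp add: mult_left_le_one_le)
        ultimately have "s *\<^sub>R e + w \<in> ball 0 r \<Longrightarrow> w \<in> B"
          by (auto simp: B_def)
        then show "d (s *\<^sub>R e + w) * indicator (ball 0 r) (s *\<^sub>R e + w) \<le> d (w + s *\<^sub>R e) * indicator B w"
          by (auto simp: indicator_def add.commute)
      qed
      finally show ?thesis .
    qed
    have bound: "of_nat N * I \<le> K * emeasure lborel B" if N: "N > 0" for N :: nat
    proof -
      have "of_nat N * I = (\<Sum>j<N. I)" by simp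
      also have "\<dots> \<le> (\<Sum>j<N. \<integral>\<^sup>+w. d (w + (j / N) *\<^sub>R e) * indicator B w \<partial>lborel)"
        by (intro sum_mono shift) (use N in auto)
      also have "\<dots> = (\<integral>\<^sup>+w. (\<Sum>j<N. d (w + (j / N) *\<^sub>R e) * indicator B w) \<partial>lborel)"
        by (rule nn_integral_sum[symmetric])
          (auto simp: B_def intro!: borel_measurable_times_ennreal borel_measurable_indicator)
      also have "\<dots> \<le> (\<integral>\<^sup>+w. K * indicator B w \<partial>lborel)"
      proof (rule nn_integral_mono)
        fix w :: 'a
        have "(\<Sum>j<N. d (w + (j / N) *\<^sub>R e)) \<le> K"
          unfolding d_def K_def using sum_gaps_le[OF N, of w] lower_le_upper
          by (subst sum_ennreal) (auto intro: ennreal_leI)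
        then show "(\<Sum>j<N. d (w + (j / N) *\<^sub>R e) * indicator B w) \<le> K * indicator B w"
          by (auto simp: indicator_def)
      qed
      also have "\<dots> = K * emeasure lborel B"
        by (rule nn_integral_cmult_indicator) (simp add: B_def)
      finally show ?thesis .
    qed
    have "emeasure lborel B < top"
      using emeasure_bounded_finite[of B] by (simp add: B_def infinity_ennreal_def)
    then have "K * emeasure lborel B < top"
      by (simp add: K_def ennreal_mult_less_top)
    then obtain C where C: "C \<ge> 0" "K * emeasure lborel B = ennreal C"
      by (cases "K * emeasure lborel B") auto
    with bound[of 1] have "I < \<infinity>" by (auto intro: le_less_trans)
    then obtain i where i: "i \<ge> 0" "I = ennreal i" by (cases I) auto
    have "real N * i \<le> C" for N :: nat
      using bound[of N] C i by (cases "N = 0")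
        (auto simp: ennreal_of_nat_eq_real_of_nat ennreal_mult[symmetric])
    then have "\<not> i > 0"
      using reals_Archimedean3[of i] by (meson linorder_not_le)
    then have "i = 0" using i by simp
    then show ?thesis using i by (simp add: I_def)
  qed
  then have "AE w in lborel. d w * indicator (ball 0 (real n)) w = 0" for n :: nat
    by (subst (asm) nn_integral_0_iff_AE)
      (auto intro!: borel_measurable_times_ennreal borel_measurable_indicator)
  then have "AE w in lborel. \<forall>n::nat. d w * indicator (ball 0 (real n)) w = 0"
    unfolding AE_all_countable by blast
  then show ?thesis
  proof eventually_elim
    case (elim w)
    obtain n :: nat where "norm w < n" using reals_Archimedean2 by blast
    then have "w \<in> ball 0 (real n)" by simp
    with elim[rule_format, of n] have "d w = 0" by simp
    then show ?case using lower_le_upper[of w] by (simp add: d_def ennreal_eq_0_iff)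
  qed
qed

end

section \<open>Averages over an absolutely continuous probability measure\<close>

lemma AE_lborel_reflect:
  fixes z :: "'a::euclidean_space"
  assumes "AE w in lborel. P w"
  shows "AE u in lborel. P (z - u)"
proof -
  have reflect: "distr lborel borel (\<lambda>u. z - u) = lborel"
    using lborel_affine[of "-1" z] by (simp add: density_1)
  have "AE w in distr lborel borel (\<lambda>u. z - u). P w"
    unfolding reflect by (fact assms)
  then show ?thesis
    by (rule AE_distrD[rotated]) simp
qed

definition convolve :: "'a::real_vector measure \<Rightarrow> ('a \<Rightarrow> real) \<Rightarrow> 'a \<Rightarrow> real" where
  "convolve M f z = (LINT u|M. f (z - u))"

text \<open>The measure with density \<open>\<psi> \<epsilon>\<close> in the form in which it is used: a probability measure that
  does not charge Lebesgue null sets.\<close>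

locale averaging = finite_measure M for M :: "'a::euclidean_space measure" +
  assumes sets_M: "sets M = sets lebesgue"
    and total: "measure M (space M) = 1"
    and ac: "\<And>P. AE u in lborel. P u \<Longrightarrow> AE u in M. P u"
begin

lemma measurable_reflect:
  fixes f :: "'a \<Rightarrow> real"
  assumes f: "f \<in> borel_measurable borel"
  shows "(\<lambda>u. f (z - u)) \<in> borel_measurable M"
proof -
  have "(\<lambda>u. f (z - u)) \<in> borel_measurable borel" using f by measurable
  then have "(\<lambda>u. f (z - u)) \<in> borel_measurable lebesgue"
    by (simp add: measurable_completion)
  then show ?thesis using measurable_cong_sets[OF sets_M refl] by blast
qed

lemma integrable_reflect:
  fixes f :: "'a \<Rightarrow> real"
  assumes "f \<in> borel_measurable borel" and "AE u in M. \<bar>f (z - u)\<bar> \<le> B"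
  shows "integrable M (\<lambda>u. f (z - u))"
  by (rule integrable_const_bound[where B = B]) (use assms measurable_reflect[OF assms(1)] in simp_all)

text \<open>Discontinuities of \<open>f\<close> on a null set are invisible to \<open>M\<close>, so dominated convergence
  applies.\<close>

lemma continuous_convolve:
  fixes f :: "'a \<Rightarrow> real"
  assumes f: "f \<in> borel_measurable borel" and bound: "\<And>w. \<bar>f w\<bar> \<le> B"
    and cont: "AE w in lborel. isCont f w"
  shows "continuous_on UNIV (convolve M f)"
proof (rule continuous_on_sequentiallyI)
  fix zs z assume zs: "zs \<longlonglongrightarrow> (z::'a)"
  show "(\<lambda>n. convolve M f (zs n)) \<longlonglongrightarrow> convolve M f z"
    unfolding convolve_def
  proof (rule integral_dominated_convergence[where w = "\<lambda>_. B"])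
    have "AE u in M. isCont f (z - u)" by (intro ac AE_lborel_reflect cont)
    then show "AE u in M. (\<lambda>n. f (zs n - u)) \<longlonglongrightarrow> f (z - u)"
    proof eventually_elim
      case (elim u)
      then show ?case by (rule isCont_tendsto_compose) (intro tendsto_intros zs)
    qed
  qed (use bound in \<open>auto intro!: measurable_reflect[OF f]\<close>)
qed

text \<open>For a Lipschitz function two translates differ by a bounded function. Hence integrability of
  \<open>u \<mapsto> c (z - u)\<close> does not depend on \<open>z\<close>. This matters since the measure may have unbounded
  support and no first moment, in which case the Bochner integral is \<open>0\<close> for every \<open>z\<close>.\<close>

lemma integrable_lipschitz_transfer:
  fixes c :: "'a \<Rightarrow> real"
  assumes lip: "L-lipschitz_on UNIV c" and int: "integrable M (\<lambda>u. c (z - u))"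
  shows "integrable M (\<lambda>u. c (w - u))"
proof -
  have c: "c \<in> borel_measurable borel"
    using lip by (intro borel_measurable_continuous_onI lipschitz_on_continuous_on)
  have "integrable M (\<lambda>u. c (w - u) - c (z - u))"
  proof (rule integrable_const_bound)
    show "AE u in M. norm (c (w - u) - c (z - u)) \<le> L * norm (w - z)"
    proof (rule AE_I2)
      show "norm (c (w - u) - c (z - u)) \<le> L * norm (w - z)" for u
        using lipschitz_onD[OF lip, of "w - u" "z - u"] by (simp add: dist_norm)
    qed
  qed (intro borel_measurable_diff measurable_reflect[OF c])
  from Bochner_Integration.integrable_add[OF this int] show ?thesis by simp
qed

lemma convolve_not_integrable:
  fixes c :: "'a \<Rightarrow> real"
  assumes "L-lipschitz_on UNIV c" and "\<not> integrable M (\<lambda>u. c (z - u))"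
  shows "convolve M c w = 0"
proof -
  have "\<not> integrable M (\<lambda>u. c (w - u))"
    using integrable_lipschitz_transfer[OF assms(1), of w z] assms(2) by blast
  then show ?thesis unfolding convolve_def by (rule not_integrable_integral_eq)
qed

lemma convolve_minus: "convolve M (\<lambda>w. - c w) z = - convolve M c z"
  by (simp add: convolve_def)

text \<open>In the absence of integrability the average is the constant \<open>0\<close>, which is convex as well.\<close>

lemma convex_convolve:
  assumes lip: "L-lipschitz_on UNIV c"
    and cvx: "\<And>u. convex_on UNIV (\<lambda>x. c (T x - u))"
  shows "convex_on UNIV (\<lambda>x. convolve M c (T x))"
proof (cases "integrable M (\<lambda>u. c (0 - u))")
  case False
  then show ?thesis
    using convolve_not_integrable[OF lip False] by (simp add: convex_on_def)
next
  case True
  then have int: "integrable M (\<lambda>u. c (z - u))" for z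
    by (rule integrable_lipschitz_transfer[OF lip])
  show ?thesis
    unfolding convex_on_def
  proof (intro conjI ballI allI impI)
    fix x y and p q :: real assume pq: "0 \<le> p" "0 \<le> q" "p + q = 1"
    have "convolve M c (T (p *\<^sub>R x + q *\<^sub>R y)) \<le> (LINT u|M. p * c (T x - u) + q * c (T y - u))"
      unfolding convolve_def
    proof (rule integral_mono)
      show "c (T (p *\<^sub>R x + q *\<^sub>R y) - u) \<le> p * c (T x - u) + q * c (T y - u)" for u
        using cvx[of u] pq unfolding convex_on_def by blast
    qed (intro Bochner_Integration.integrable_add integrable_mult_right int)+
    also have "\<dots> = p * convolve M c (T x) + q * convolve M c (T y)"
      by (simp add: convolve_def int)
    finally show "convolve M c (T (p *\<^sub>R x + q *\<^sub>R y)) \<le> p * convolve M c (T x) + q * convolve M c (T y)" .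
  qed simp
qed

text \<open>A pointwise bound on increments of \<open>c\<close> passes to increments of its average; this transports
  bounds on difference quotients.\<close>

lemma convolve_mono_diff:
  assumes "integrable M (\<lambda>u. c (z - u))" "integrable M (\<lambda>u. c (w - u))"
    and "AE u in M. c (w - u) - c (z - u) \<le> C"
  shows "convolve M c w - convolve M c z \<le> C"
proof -
  have "convolve M c w - convolve M c z = (LINT u|M. c (w - u) - c (z - u))"
    by (simp add: convolve_def assms(1,2))
  also have "\<dots> \<le> (LINT u|M. C)"
    using assms by (intro integral_mono_AE Bochner_Integration.integrable_diff) simp_all
  also have "\<dots> = C" using total by simp
  finally show ?thesis .
qed

lemma integrable_concentrated:
  fixes c :: "'a \<Rightarrow> real"
  assumes lip: "L-lipschitz_on UNIV c" and conc: "AE u in M. norm u < \<delta>"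
  shows "integrable M (\<lambda>u. c (z - u))"
proof (rule integrable_reflect[where f = c])
  show "c \<in> borel_measurable borel"
    using lip by (intro borel_measurable_continuous_onI lipschitz_on_continuous_on)
  show "AE u in M. \<bar>c (z - u)\<bar> \<le> \<bar>c z\<bar> + L * \<delta>"
    using conc
  proof eventually_elim
    case (elim u)
    have "\<bar>c (z - u) - c z\<bar> \<le> L * norm u"
      using lipschitz_onD[OF lip, of "z - u" z] by (simp add: dist_norm)
    also have "\<dots> \<le> L * \<delta>"
      using elim lipschitz_on_nonneg[OF lip] by (intro mult_left_mono) auto
    finally show ?case by linarith
  qed
qed

lemma convolve_near:
  assumes lip: "L-lipschitz_on UNIV c" and conc: "AE u in M. norm u < \<delta>"
  shows "\<bar>convolve M c w - c z\<bar> \<le> L * (norm (w - z) + \<delta>)"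
proof -
  note int = integrable_concentrated[OF lip conc]
  have "convolve M c w - c z = (LINT u|M. c (w - u) - c z)"
    using total by (simp add: convolve_def int)
  also have "\<bar>\<dots>\<bar> \<le> (LINT u|M. \<bar>c (w - u) - c z\<bar>)"
    by (rule integral_abs_bound)
  also have "\<dots> \<le> (LINT u|M. L * (norm (w - z) + \<delta>))"
  proof (rule integral_mono_AE)
    show "AE u in M. \<bar>c (w - u) - c z\<bar> \<le> L * (norm (w - z) + \<delta>)"
      using conc
    proof eventually_elim
      case (elim u)
      have "\<bar>c (w - u) - c z\<bar> \<le> L * norm (w - u - z)"
        using lipschitz_onD[OF lip, of "w - u" z] by (simp add: dist_norm)
      also have "norm (w - u - z) \<le> norm (w - z) + \<delta>"
        using norm_triangle_ineq4[of "w - z" u] elim by (simp add: algebra_simps)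
      finally show ?case
        using elim lipschitz_on_nonneg[OF lip] by (simp add: mult_left_mono)
    qed
  qed (intro integrable_abs Bochner_Integration.integrable_diff int integrable_const)+
  also have "\<dots> = L * (norm (w - z) + \<delta>)" using total by simp
  finally show ?thesis .
qed

end

locale convex_average = convex_direction c L e + averaging M
  for c :: "'a::euclidean_space \<Rightarrow> real" and L e M +
  assumes int: "integrable M (\<lambda>u. c (z - u))"
begin

lemma continuous_convolve_slope: "continuous_on UNIV (convolve M (upper_slope c e))"
proof (rule continuous_convolve)
  show "AE w in lborel. isCont (upper_slope c e) w"
    using AE_slopes_eq by eventually_elim (rule isCont_upper_slope)
qed (fact upper_slope_measurable upper_slope_bound)+

text \<open>The upper slope is a subgradient of \<open>c\<close> along \<open>e\<close>, and subgradient inequalities can be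
  integrated.\<close>

lemma convolve_slope_subgradient:
  "t * convolve M (upper_slope c e) z \<le> convolve M c (z + t *\<^sub>R e) - convolve M c z"
proof -
  have "t * convolve M (upper_slope c e) z = (LINT u|M. t * upper_slope c e (z - u))"
    by (simp add: convolve_def)
  also have "\<dots> \<le> (LINT u|M. c (z + t *\<^sub>R e - u) - c (z - u))"
  proof (rule integral_mono)
    show "integrable M (\<lambda>u. t * upper_slope c e (z - u))"
      by (intro integrable_mult_right integrable_reflect[OF upper_slope_measurable, where B = "L * norm e"]
        AE_I2 upper_slope_bound)
    show "t * upper_slope c e (z - u) \<le> c (z + t *\<^sub>R e - u) - c (z - u)" for u
      using upper_slope_subgradient[of t "z - u"] by (simp add: algebra_simps)
  qed (intro Bochner_Integration.integrable_diff int)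
  also have "\<dots> = convolve M c (z + t *\<^sub>R e) - convolve M c z"
    by (simp add: convolve_def int)
  finally show ?thesis .
qed

text \<open>The subgradient inequality at \<open>z\<close> and at \<open>z + t e\<close> encloses the difference quotient between
  the averaged slopes at these two points, and the averaged slope is continuous.\<close>

lemma convolve_has_slope:
  "((\<lambda>t. convolve M c (z + t *\<^sub>R e)) has_real_derivative convolve M (upper_slope c e) z) (at 0)"
proof -
  let ?F = "convolve M c" and ?G = "convolve M (upper_slope c e)"
  have "((\<lambda>t. (?F (z + t *\<^sub>R e) - ?F z) / t - ?G z) \<longlongrightarrow> 0) (at 0)"
  proof (rule Lim_null_comparison)
    show "\<forall>\<^sub>F t in at 0. norm ((?F (z + t *\<^sub>R e) - ?F z) / t - ?G z) \<le> \<bar>?G (z + t *\<^sub>R e) - ?G z\<bar>"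
    proof (rule eventually_mono[OF eventually_neq_at_within])
      fix t :: real assume t: "t \<noteq> 0"
      have lo: "t * ?G z \<le> ?F (z + t *\<^sub>R e) - ?F z"
        by (rule convolve_slope_subgradient)
      have up: "?F (z + t *\<^sub>R e) - ?F z \<le> t * ?G (z + t *\<^sub>R e)"
        using convolve_slope_subgradient[of "-t" "z + t *\<^sub>R e"] by simp
      have "norm (x / t - p) \<le> \<bar>q - p\<bar>" if "t * p \<le> x" "x \<le> t * q" for x p q :: real
      proof -
        have "\<bar>x / t - p\<bar> * \<bar>t\<bar> = \<bar>x - p * t\<bar>"
          unfolding abs_mult[symmetric] using t by (simp add: left_diff_distrib)
        also have "\<dots> \<le> \<bar>t * (q - p)\<bar>"
          using that by (simp add: right_diff_distrib mult.commute[of p t])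
        finally show ?thesis using t by (simp add: abs_mult mult.commute)
      qed
      from this[OF lo up]
      show "norm ((?F (z + t *\<^sub>R e) - ?F z) / t - ?G z) \<le> \<bar>?G (z + t *\<^sub>R e) - ?G z\<bar>" .
    qed
    show "((\<lambda>t. \<bar>?G (z + t *\<^sub>R e) - ?G z\<bar>) \<longlongrightarrow> 0) (at 0)"
    proof -
      have "((\<lambda>t. ?G (z + t *\<^sub>R e)) \<longlongrightarrow> ?G z) (at 0)"
      proof (rule isCont_tendsto_compose[of z ?G])
        show "isCont ?G z"
          using continuous_convolve_slope by (simp add: continuous_on_eq_continuous_at)
        show "((\<lambda>t. z + t *\<^sub>R e) \<longlongrightarrow> z) (at 0)"
          by (auto intro!: tendsto_eq_intros)
      qed
      then have "((\<lambda>t. ?G (z + t *\<^sub>R e) - ?G z) \<longlongrightarrow> 0) (at 0)" by (rule LIM_zero)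
      then show ?thesis by (rule tendsto_rabs_zero)
    qed
  qed
  then show ?thesis
    unfolding DERIV_def add_0 scaleR_zero_left add_0_right by (rule LIM_zero_cancel)
qed

end

context averaging
begin

text \<open>The averaged slopes are continuous partial derivatives. A concave direction is
  treated through \<open>- c\<close>.\<close>

lemma convolve_C1:
  assumes lip: "L-lipschitz_on UNIV c"
    and lines: "\<And>b. b \<in> Basis \<Longrightarrow>
      (\<forall>w. convex_on UNIV (\<lambda>t. c (w + t *\<^sub>R b))) \<or> (\<forall>w. concave_on UNIV (\<lambda>t. c (w + t *\<^sub>R b)))"
  shows "\<exists>g. (\<forall>z. GDERIV (convolve M c) z :> g z) \<and> continuous_on UNIV g"
proof (cases "integrable M (\<lambda>u. c (0 - u))")
  case False
  then have zero: "convolve M c = (\<lambda>_. 0)"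
    using convolve_not_integrable[OF lip] by blast
  show ?thesis
    by (intro exI[of _ "\<lambda>_. 0"]) (simp add: zero GDERIV_const)
next
  case True
  then have int: "integrable M (\<lambda>u. c (z - u))" for z
    using integrable_lipschitz_transfer[OF lip] by blast
  have "\<exists>g. continuous_on UNIV g \<and>
      (\<forall>w. ((\<lambda>t. convolve M c (w + t *\<^sub>R b)) has_real_derivative g w) (at 0))" if "b \<in> Basis" for b
    using lines[OF that]
  proof
    assume "\<forall>w. convex_on UNIV (\<lambda>t. c (w + t *\<^sub>R b))"
    then interpret convex_average c L b M
      by unfold_locales (use lip int in auto)
    show ?thesis using continuous_convolve_slope convolve_has_slope by blast
  next
    assume "\<forall>w. concave_on UNIV (\<lambda>t. c (w + t *\<^sub>R b))"
    then interpret convex_average "\<lambda>w. - c w" L b M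
      by unfold_locales (use lip int in \<open>auto simp: concave_on_def lipschitz_on_def dist_minus\<close>)
    let ?g = "convolve M (upper_slope (\<lambda>w. - c w) b)"
    have "((\<lambda>t. convolve M c (w + t *\<^sub>R b)) has_real_derivative - ?g w) (at 0)" for w
      using DERIV_minus[OF convolve_has_slope[of w]] by (simp add: convolve_minus)
    moreover have "continuous_on UNIV (\<lambda>w. - ?g w)"
      by (intro continuous_on_minus continuous_convolve_slope)
    ultimately show ?thesis by blast
  qed
  then obtain G where G: "\<And>b. b \<in> Basis \<Longrightarrow> continuous_on UNIV (G b)"
    "\<And>b w. b \<in> Basis \<Longrightarrow> ((\<lambda>t. convolve M c (w + t *\<^sub>R b)) has_real_derivative G b w) (at 0)"
    by metis
  show ?thesis
  proof (intro exI conjI allI)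
    show "GDERIV (convolve M c) z :> (\<Sum>b\<in>Basis. G b z *\<^sub>R b)" for z
      by (intro GDERIV_from_continuous_partials G)
    show "continuous_on UNIV (\<lambda>z. \<Sum>b\<in>Basis. G b z *\<^sub>R b)"
      by (intro continuous_intros G)
  qed
qed

end

section \<open>Limits of gradients and Clarke subgradients\<close>

text \<open>The limit superior is an infimum of eventual upper bounds, and it suffices to test real ones.\<close>

lemma le_clarke_derivI:
  assumes "\<And>C. \<forall>\<^sub>F (y, t) in nhds x \<times>\<^sub>F at_right 0. (f (y + t *\<^sub>R v) - f y) / t < C \<Longrightarrow> a \<le> C"
  shows "ereal a \<le> clarke_deriv f x v"
proof (rule ccontr)
  assume "\<not> ereal a \<le> clarke_deriv f x v"
  then obtain C where C: "clarke_deriv f x v < ereal C" "C < a"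
    by (metis ereal_dense2 ereal_less_eq(3) linorder_not_le)
  have "\<forall>\<^sub>F (y, t) in nhds x \<times>\<^sub>F at_right 0. (f (y + t *\<^sub>R v) - f y) / t < C"
    using Limsup_lessD[OF C(1)[unfolded clarke_deriv_def]]
    by (rule eventually_mono) auto
  with assms C(2) show False by force
qed

text \<open>Subgradients of convex analysis are Clarke subgradients: the base point of the difference quotient
  can be kept at \<open>x\<close>.\<close>

lemma clarke_subdiff_convex:
  assumes "\<And>h. \<xi> \<bullet> h \<le> f (x + h) - f x"
  shows "\<xi> \<in> clarke_subdiff f x"
  unfolding clarke_subdiff_def
proof (intro CollectI allI le_clarke_derivI)
  fix v C assume ev: "\<forall>\<^sub>F (y, t) in nhds x \<times>\<^sub>F at_right 0. (f (y + t *\<^sub>R v) - f y) / t < C"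
  have "filterlim (\<lambda>t. (x, t)) (nhds x \<times>\<^sub>F at_right 0) (at_right (0::real))"
    by (intro filterlim_Pair tendsto_const filterlim_ident)
  from filterlim_iff[THEN iffD1, OF this, rule_format, OF ev]
  have "\<forall>\<^sub>F t in at_right 0. (f (x + t *\<^sub>R v) - f x) / t < C \<and> 0 < t"
    using eventually_at_right_less[of 0] by (auto elim: eventually_elim2)
  then obtain t where t: "(f (x + t *\<^sub>R v) - f x) / t < C" "0 < t"
    using eventually_happens by fastforce
  have "\<xi> \<bullet> v \<le> (f (x + t *\<^sub>R v) - f x) / t"
    using assms[of "t *\<^sub>R v"] t by (simp add: field_simps)
  then show "\<xi> \<bullet> v \<le> C" using t by linarith
qed

text \<open>For a supergradient the favourable base points are \<open>x - t v\<close>: the quotient from there to \<open>x\<close>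
  is at least \<open>\<xi> \<bullet> v\<close>.\<close>

lemma clarke_subdiff_concave:
  assumes "\<And>h. f (x + h) - f x \<le> \<xi> \<bullet> h"
  shows "\<xi> \<in> clarke_subdiff f x"
  unfolding clarke_subdiff_def
proof (intro CollectI allI le_clarke_derivI)
  fix v C assume ev: "\<forall>\<^sub>F (y, t) in nhds x \<times>\<^sub>F at_right 0. (f (y + t *\<^sub>R v) - f y) / t < C"
  have "((\<lambda>t. x - t *\<^sub>R v) \<longlongrightarrow> x) (at_right (0::real))"
    by (auto intro!: tendsto_eq_intros)
  then have "filterlim (\<lambda>t. (x - t *\<^sub>R v, t)) (nhds x \<times>\<^sub>F at_right 0) (at_right (0::real))"
    by (intro filterlim_Pair filterlim_ident)
  from filterlim_iff[THEN iffD1, OF this, rule_format, OF ev]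
  have "\<forall>\<^sub>F t in at_right 0. (f x - f (x - t *\<^sub>R v)) / t < C \<and> 0 < t"
    using eventually_at_right_less[of 0] by (auto elim: eventually_elim2)
  then obtain t where t: "(f x - f (x - t *\<^sub>R v)) / t < C" "0 < t"
    using eventually_happens by fastforce
  have "\<xi> \<bullet> v \<le> (f x - f (x - t *\<^sub>R v)) / t"
    using assms[of "- t *\<^sub>R v"] t by (simp add: field_simps)
  then show "\<xi> \<bullet> v \<le> C" using t by linarith
qed

text \<open>The tangent inequality is stable under limits, even though the functions vary with \<open>k\<close>.\<close>

lemma subgradient_limit:
  assumes "\<And>k. convex_on UNIV (f k)" "\<And>k. GDERIV (f k) (xs k) :> v k"
    and "v \<longlonglongrightarrow> \<xi>" "\<And>h. (\<lambda>k. f k (xs k + h)) \<longlonglongrightarrow> F (x + h)"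
  shows "\<xi> \<bullet> h \<le> F (x + h) - F x"
proof (rule LIMSEQ_le)
  show "(\<lambda>k. v k \<bullet> h) \<longlonglongrightarrow> \<xi> \<bullet> h" by (intro tendsto_intros assms)
  show "(\<lambda>k. f k (xs k + h) - f k (xs k)) \<longlonglongrightarrow> F (x + h) - F x"
    by (rule tendsto_diff[OF assms(4)[of h] assms(4)[of 0, simplified]])
  show "\<exists>N. \<forall>n\<ge>N. v n \<bullet> h \<le> f n (xs n + h) - f n (xs n)"
    using convex_on_above_gradient[OF assms(1,2)] by blast
qed

locale shrinking_averages =
  fixes M :: "real \<Rightarrow> 'a::euclidean_space measure"
  assumes avg: "\<And>\<epsilon>. \<epsilon> \<in> {0<..1} \<Longrightarrow> averaging (M \<epsilon>)"
    and shrink: "\<And>\<delta>. \<delta> > 0 \<Longrightarrow> \<forall>\<^sub>F \<epsilon> in at_right 0. AE u in M \<epsilon>. norm u < \<delta>"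
begin

lemma eventually_averaging:
  assumes "\<delta> > 0"
  shows "\<forall>\<^sub>F \<epsilon> in at_right 0. averaging (M \<epsilon>) \<and> (AE u in M \<epsilon>. norm u < \<delta>)"
proof -
  have "\<forall>\<^sub>F \<epsilon> in at_right (0::real). \<epsilon> \<in> {0<..<1}"
    by (rule eventually_at_right_real) simp
  with shrink[OF assms] show ?thesis
    by eventually_elim (auto intro: avg)
qed

lemma convolve_tendsto:
  assumes lip: "L-lipschitz_on UNIV c"
  shows "((\<lambda>(w, \<epsilon>). convolve (M \<epsilon>) c w) \<longlongrightarrow> c z) (nhds z \<times>\<^sub>F at_right 0)"
proof (rule tendstoI)
  fix e :: real assume e: "e > 0"
  have L: "L \<ge> 0" using lip by (rule lipschitz_on_nonneg)
  define \<delta> where "\<delta> = e / (2 * (L + 1))"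
  have \<delta>: "\<delta> > 0" using e L by (simp add: \<delta>_def)
  have "\<forall>\<^sub>F w in nhds z. norm (w - z) < \<delta>"
    using \<delta> by (auto simp: eventually_nhds_metric dist_norm)
  then have "\<forall>\<^sub>F p in nhds z \<times>\<^sub>F at_right 0. norm (fst p - z) < \<delta> \<and>
      averaging (M (snd p)) \<and> (AE u in M (snd p). norm u < \<delta>)"
    using eventually_averaging[OF \<delta>] by (rule eventually_prodI[THEN eventually_mono]) auto
  then show "\<forall>\<^sub>F p in nhds z \<times>\<^sub>F at_right 0. dist (case p of (w, \<epsilon>) \<Rightarrow> convolve (M \<epsilon>) c w) (c z) < e"
  proof eventually_elim
    case (elim p)
    then interpret averaging "M (snd p)" by simp
    have "\<bar>convolve (M (snd p)) c (fst p) - c z\<bar> \<le> L * (norm (fst p - z) + \<delta>)"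
      using elim by (intro convolve_near lip) simp
    also have "\<dots> \<le> L * (2 * \<delta>)"
      using elim L by (intro mult_left_mono) auto
    also have "\<dots> < (L + 1) * (2 * \<delta>)" using \<delta> by simp
    also have "\<dots> = e" unfolding \<delta>_def using L by (simp add: divide_eq_eq)
    finally show ?case by (simp add: case_prod_beta dist_real_def)
  qed
qed

text \<open>If every difference quotient of \<open>c\<close> in direction \<open>d\<close> near \<open>z\<close> is at most \<open>C\<close>, then so is
  every average of such quotients over a measure concentrated near \<open>0\<close>. Directional derivatives of
  the averages are limits of these averaged quotients.\<close>

lemma gradient_limit_clarke:
  assumes lip: "L-lipschitz_on UNIV c"
    and zs: "zs \<longlonglongrightarrow> z" and es: "filterlim es (at_right 0) sequentially"
    and deriv: "\<And>k. GDERIV (convolve (M (es k)) c) (zs k) :> v k" and v: "v \<longlonglongrightarrow> \<xi>"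
  shows "\<xi> \<in> clarke_subdiff c z"
  unfolding clarke_subdiff_def
proof (intro CollectI allI le_clarke_derivI)
  fix d C assume "\<forall>\<^sub>F (y, t) in nhds z \<times>\<^sub>F at_right 0. (c (y + t *\<^sub>R d) - c y) / t < C"
  then obtain P Q where PQ: "eventually P (nhds z)" "eventually Q (at_right 0)"
    "\<And>y t. P y \<Longrightarrow> Q t \<Longrightarrow> (c (y + t *\<^sub>R d) - c y) / t < C"
    by (auto simp: eventually_prod_filter)
  obtain r where r: "r > 0" "\<And>y. dist y z < r \<Longrightarrow> P y"
    using PQ(1) by (auto simp: eventually_nhds_metric)
  have r2: "r / 2 > 0" using r by simp
  have near: "\<forall>\<^sub>F k in sequentially. dist (zs k) z < r / 2"
    using zs r2 by (rule tendstoD)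
  have conc: "\<forall>\<^sub>F k in sequentially. averaging (M (es k)) \<and> (AE u in M (es k). norm u < r / 2)"
    using es eventually_averaging[OF r2] by (auto simp: filterlim_iff)
  have "\<forall>\<^sub>F k in sequentially. v k \<bullet> d \<le> C"
    using near conc
  proof eventually_elim
    case (elim k)
    then interpret averaging "M (es k)" by simp
    let ?F = "convolve (M (es k)) c"
    have "((\<lambda>t. (?F (zs k + t *\<^sub>R d) - ?F (zs k)) / t) \<longlongrightarrow> v k \<bullet> d) (at 0)"
      using GDERIV_line[OF deriv[of k], of d] by (simp add: DERIV_def)
    then have "((\<lambda>t. (?F (zs k + t *\<^sub>R d) - ?F (zs k)) / t) \<longlongrightarrow> v k \<bullet> d) (at_right 0)"
      by (rule filterlim_mono) (auto simp: at_le)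
    moreover have "\<forall>\<^sub>F t in at_right 0. (?F (zs k + t *\<^sub>R d) - ?F (zs k)) / t \<le> C"
      using PQ(2) eventually_at_right_less[of 0]
    proof eventually_elim
      fix t :: real assume t: "Q t" "0 < t"
      have "?F (zs k + t *\<^sub>R d) - ?F (zs k) \<le> t * C"
      proof (rule convolve_mono_diff)
        show "AE u in M (es k). c (zs k + t *\<^sub>R d - u) - c (zs k - u) \<le> t * C"
          using elim(2)[THEN conjunct2]
        proof eventually_elim
          fix u :: 'a assume u: "norm u < r / 2"
          have "dist (zs k - u) z \<le> dist (zs k) z + norm u"
            using norm_triangle_ineq4[of "zs k - z" u] by (simp add: dist_norm algebra_simps)
          then have "P (zs k - u)" using u elim(1) r(2) by force
          from PQ(3)[OF this t(1)] t(2)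
          show "c (zs k + t *\<^sub>R d - u) - c (zs k - u) \<le> t * C"
            by (simp add: divide_less_eq algebra_simps)
        qed
      qed (use integrable_concentrated[OF lip] elim in blast)+
      then show "(?F (zs k + t *\<^sub>R d) - ?F (zs k)) / t \<le> C"
        using t(2) by (simp add: divide_le_eq mult.commute)
    qed
    ultimately show "v k \<bullet> d \<le> C"
      by (rule tendsto_upperbound) simp
  qed
  moreover have "(\<lambda>k. v k \<bullet> d) \<longlonglongrightarrow> \<xi> \<bullet> d" by (intro tendsto_intros v)
  ultimately show "\<xi> \<bullet> d \<le> C"
    by (intro tendsto_upperbound[of "\<lambda>k. v k \<bullet> d"]) auto
qed

end

section \<open>Averages of convex-concave functions\<close>

lemma averaging_density:
  fixes w :: "'a::euclidean_space \<Rightarrow> real"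
  assumes w: "w \<in> borel_measurable lebesgue" and nonneg: "\<And>u. w u \<ge> 0"
    and one: "(LINT u|lebesgue. w u) = 1"
  shows "averaging (density lebesgue (\<lambda>u. ennreal (w u)))"
proof -
  let ?M = "density lebesgue (\<lambda>u. ennreal (w u))"
  have "integrable lebesgue w"
    using one not_integrable_integral_eq[of lebesgue w] by fastforce
  then have "(\<integral>\<^sup>+u. ennreal (w u) \<partial>lebesgue) = 1"
    using nn_integral_eq_integral[of lebesgue w] nonneg one by simp
  then have mass: "emeasure ?M (space ?M) = 1"
    using w by (subst emeasure_density) (simp_all add: nn_integral_set_ennreal)
  interpret finite_measure ?M
    by (rule finite_measureI) (simp only: mass, simp)
  show ?thesis
  proof
    show "measure ?M (space ?M) = 1" by (simp only: measure_def mass enn2real_1)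
    fix P assume "AE u in lborel. P (u :: 'a)"
    then have "AE u in lebesgue. P u" by (rule AE_completion)
    then show "AE u in ?M. P u" using w by (subst AE_density) auto
  qed simp
qed

lemma averaged_eq_convolve:
  assumes c: "continuous_on UNIV c" and w: "\<psi> \<epsilon> \<in> borel_measurable lebesgue" and nonneg: "\<And>u. \<psi> \<epsilon> u \<ge> 0"
  shows "averaged c \<psi> z \<epsilon> = convolve (density lebesgue (\<lambda>u. ennreal (\<psi> \<epsilon> u))) c z"
proof -
  have "(\<lambda>u. c (z - u)) \<in> borel_measurable borel"
    by (intro borel_measurable_continuous_onI continuous_on_compose2[OF c] continuous_intros) auto
  then have "(\<lambda>u. c (z - u)) \<in> borel_measurable lebesgue"
    by (simp add: measurable_completion)
  from integral_density[OF this w] nonneg show ?thesis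
    by (simp add: averaged_def convolve_def mult.commute)
qed

locale saddle_function =
  fixes c :: "'a::euclidean_space \<times> 'b::euclidean_space \<Rightarrow> real" and L :: real
  assumes lip: "L-lipschitz_on UNIV c"
    and convex_x: "\<And>y. convex_on UNIV (\<lambda>x. c (x, y))"
    and concave_y: "\<And>x. concave_on UNIV (\<lambda>y. c (x, y))"
begin

lemma lip_minus: "L-lipschitz_on UNIV (\<lambda>z. - c z)"
  using lip by (auto simp: lipschitz_on_def dist_minus)

lemma basis_lines:
  assumes b: "b \<in> Basis"
  shows "(\<forall>w. convex_on UNIV (\<lambda>t. c (w + t *\<^sub>R b))) \<or> (\<forall>w. concave_on UNIV (\<lambda>t. c (w + t *\<^sub>R b)))"
proof -
  have lin: "linear (\<lambda>t. t *\<^sub>R v)" for v :: "'v::real_vector"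
    by (auto intro!: linearI simp: algebra_simps)
  consider u where "b = (u, 0)" | v where "b = (0, v)"
    using b by (auto simp: Basis_prod_def)
  then show ?thesis
  proof cases
    case 1
    have "convex_on UNIV (\<lambda>t. c (w + t *\<^sub>R b))" for w
      using convex_on_compose_affine[OF convex_x[of "snd w"] lin[of u], of "fst w"]
      by (simp add: 1 plus_prod_def)
    then show ?thesis by blast
  next
    case 2
    have "concave_on UNIV (\<lambda>t. c (w + t *\<^sub>R b))" for w
      using convex_on_compose_affine[OF concave_y[of "fst w", unfolded concave_on_def] lin[of v], of "snd w"]
      by (simp add: 2 plus_prod_def concave_on_def)
    then show ?thesis by blast
  qed
qed

lemma convex_average_x:
  assumes "averaging M"
  shows "convex_on UNIV (\<lambda>x. convolve M c (x, y))"
proof -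
  interpret averaging M by fact
  show ?thesis
  proof (rule convex_convolve[OF lip])
    fix u :: "'a \<times> 'b"
    have "convex_on UNIV (\<lambda>x. c (- fst u + x, y - snd u))"
      by (rule convex_on_compose_affine[OF convex_x linear_ident])
    then show "convex_on UNIV (\<lambda>x. c ((x, y) - u))" by (simp add: minus_prod_def)
  qed
qed

lemma concave_average_y:
  assumes "averaging M"
  shows "concave_on UNIV (\<lambda>y. convolve M c (x, y))"
proof -
  interpret averaging M by fact
  have "convex_on UNIV (\<lambda>y. convolve M (\<lambda>z. - c z) (x, y))"
  proof (rule convex_convolve[OF lip_minus])
    fix u :: "'a \<times> 'b"
    have "convex_on UNIV (\<lambda>y. - c (x - fst u, - snd u + y))"
      by (rule convex_on_compose_affine[OF concave_y[unfolded concave_on_def] linear_ident])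
    then show "convex_on UNIV (\<lambda>y. - c ((x, y) - u))" by (simp add: minus_prod_def)
  qed
  then show ?thesis by (simp add: concave_on_def convolve_minus)
qed

end

locale saddle_averages = saddle_function c L + shrinking_averages M
  for c :: "'a::euclidean_space \<times> 'b::euclidean_space \<Rightarrow> real" and L
    and M :: "real \<Rightarrow> ('a \<times> 'b) measure"
begin

lemma gradient_exists:
  assumes "\<epsilon> \<in> {0<..1}"
  shows "\<exists>g. (\<forall>z. GDERIV (convolve (M \<epsilon>) c) z :> g z) \<and> continuous_on UNIV g"
proof -
  interpret averaging "M \<epsilon>" using assms by (rule avg)
  show ?thesis by (intro convolve_C1[OF lip] basis_lines)
qed

lemma GDERIV_gradient:
  assumes "\<epsilon> \<in> {0<..1}"
  shows "GDERIV (convolve (M \<epsilon>) c) z :> gradient (convolve (M \<epsilon>) c) z"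
  using gradient_exists[OF assms] gradient_eq by metis

lemma smoothing: "smoothing_function X Y c (\<lambda>z \<epsilon>. convolve (M \<epsilon>) c z)"
  unfolding smoothing_function_def
proof (intro conjI ballI)
  fix \<epsilon> :: real assume "\<epsilon> \<in> {0<..1}"
  from gradient_exists[OF this] show "cont_diff_on (X \<times> Y) (convolve (M \<epsilon>) c)"
    unfolding cont_diff_on_def by (intro exI[of _ UNIV]) simp
next
  fix x y
  let ?F = "at ((x, y), 0 :: real) within (X \<times> Y) \<times> {0<..1}"
  have "filterlim fst (nhds (x, y)) ?F"
    using tendsto_fst[OF tendsto_ident_at, of "((x, y), 0)"] by simp
  moreover have "filterlim snd (at_right 0) ?F"
  proof (rule tendsto_imp_filterlim_at_right)
    show "filterlim snd (nhds 0) ?F"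
      using tendsto_snd[OF tendsto_ident_at, of "((x, y), 0)"] by simp
    show "\<forall>\<^sub>F p in ?F. snd p > 0"
      by (auto simp: eventually_at_filter intro!: always_eventually)
  qed
  ultimately have "filterlim (\<lambda>p. (fst p, snd p)) (nhds (x, y) \<times>\<^sub>F at_right 0) ?F"
    by (rule filterlim_Pair)
  from filterlim_compose[OF convolve_tendsto[OF lip] this]
  show "((\<lambda>(z, \<epsilon>). convolve (M \<epsilon>) c z) \<longlongrightarrow> c (x, y)) ?F"
    by (simp add: case_prod_unfold)
qed

context
  fixes xs :: "nat \<Rightarrow> 'a" and ys :: "nat \<Rightarrow> 'b" and es :: "nat \<Rightarrow> real" and x y
  assumes xs: "xs \<longlonglongrightarrow> x" and ys: "ys \<longlonglongrightarrow> y"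
    and es: "\<And>k. es k \<in> {0<..1}" and es0: "es \<longlonglongrightarrow> 0"
begin

lemma es_at_right: "filterlim es (at_right 0) sequentially"
  using es by (intro tendsto_imp_filterlim_at_right es0 always_eventually) auto

lemma average_seq_tendsto:
  "(\<lambda>k. convolve (M (es k)) c (xs k + h, ys k + l)) \<longlonglongrightarrow> c (x + h, y + l)"
proof -
  have "(\<lambda>k. (xs k + h, ys k + l)) \<longlonglongrightarrow> (x + h, y + l)"
    by (intro tendsto_intros xs ys)
  then have "filterlim (\<lambda>k. ((xs k + h, ys k + l), es k)) (nhds (x + h, y + l) \<times>\<^sub>F at_right 0) sequentially"
    using es_at_right by (rule filterlim_Pair)
  from filterlim_compose[OF convolve_tendsto[OF lip] this] show ?thesis by simp
qed

lemma full_gradient_limit: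
  assumes "(\<lambda>k. gradient (convolve (M (es k)) c) (xs k, ys k)) \<longlonglongrightarrow> \<xi>"
  shows "\<xi> \<in> clarke_subdiff c (x, y)"
proof (rule gradient_limit_clarke[OF lip _ es_at_right _ assms])
  show "(\<lambda>k. (xs k, ys k)) \<longlonglongrightarrow> (x, y)" by (intro tendsto_intros xs ys)
qed (intro GDERIV_gradient es)

text \<open>Here the second argument \<open>ys k\<close> of the averages varies, whereas the subdifferential on
  the right belongs to the slice at \<open>y\<close>. Convexity bridges this gap: a tangent inequality
  involves function values only, and these converge jointly.\<close>

lemma x_gradient_limit:
  assumes lim: "(\<lambda>k. gradient (\<lambda>x. convolve (M (es k)) c (x, ys k)) (xs k)) \<longlonglongrightarrow> \<xi>"
  shows "\<xi> \<in> clarke_subdiff (\<lambda>x. c (x, y)) x"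
proof (rule clarke_subdiff_convex)
  show "\<xi> \<bullet> h \<le> c (x + h, y) - c (x, y)" for h
  proof (rule subgradient_limit[where F = "\<lambda>x. c (x, y)", OF _ _ lim])
    show "convex_on UNIV (\<lambda>x. convolve (M (es k)) c (x, ys k))" for k
      by (intro convex_average_x avg es)
    show "GDERIV (\<lambda>x. convolve (M (es k)) c (x, ys k)) (xs k)
        :> gradient (\<lambda>x. convolve (M (es k)) c (x, ys k)) (xs k)" for k
      using GDERIV_fst[OF GDERIV_gradient[OF es]] gradient_eq by metis
    show "(\<lambda>k. convolve (M (es k)) c (xs k + h, ys k)) \<longlonglongrightarrow> c (x + h, y)" for h
      using average_seq_tendsto[of h 0] by simp
  qed
qed

lemma y_gradient_limit:
  assumes lim: "(\<lambda>k. gradient (\<lambda>y. convolve (M (es k)) c (xs k, y)) (ys k)) \<longlonglongrightarrow> \<xi>"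
  shows "\<xi> \<in> clarke_subdiff (\<lambda>y. c (x, y)) y"
proof (rule clarke_subdiff_concave)
  fix h
  have "(- \<xi>) \<bullet> h \<le> - c (x, y + h) - - c (x, y)"
  proof (rule subgradient_limit[where F = "\<lambda>y. - c (x, y)", OF _ _ tendsto_minus[OF lim]])
    show "convex_on UNIV (\<lambda>y. - convolve (M (es k)) c (xs k, y))" for k
      unfolding concave_on_def[symmetric] by (intro concave_average_y avg es)
    show "GDERIV (\<lambda>y. - convolve (M (es k)) c (xs k, y)) (ys k)
        :> - gradient (\<lambda>y. convolve (M (es k)) c (xs k, y)) (ys k)" for k
      using GDERIV_minus[OF GDERIV_snd[OF GDERIV_gradient[OF es]]]
        gradient_eq[OF GDERIV_snd[OF GDERIV_gradient[OF es]]] by simp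
    show "(\<lambda>k. - convolve (M (es k)) c (xs k, ys k + h)) \<longlonglongrightarrow> - c (x, y + h)" for h
      using tendsto_minus[OF average_seq_tendsto[of 0 h]] by simp
  qed
  then show "c (x, y + h) - c (x, y) \<le> \<xi> \<bullet> h" by simp
qed

end

end

theorem proposition4p2:
  fixes c :: "(real ^ 'n) \<times> (real ^ 'm) \<Rightarrow> real"
    and X :: "(real ^ 'n) set" and Y :: "(real ^ 'm) set"
    and \<psi> :: "real \<Rightarrow> (real ^ 'n) \<times> (real ^ 'm) \<Rightarrow> real"
    and ct :: "(real ^ 'n) \<times> (real ^ 'm) \<Rightarrow> real \<Rightarrow> real"
  assumes lipschitz: "\<exists>L. L-lipschitz_on UNIV c"
    and convex_x: "\<And>y. convex_on UNIV (\<lambda>x. c (x, y))"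
    and concave_y: "\<And>x. concave_on UNIV (\<lambda>y. c (x, y))"
    and X: "convex X" "compact X"
    and Y: "convex Y" "compact Y"
    and psi_nonneg: "\<And>\<epsilon> u. \<epsilon> \<in> {0<..1} \<Longrightarrow> \<psi> \<epsilon> u \<ge> 0"
    and psi_bounded: "\<And>\<epsilon>. \<epsilon> \<in> {0<..1} \<Longrightarrow> bounded (range (\<psi> \<epsilon>))"
    and psi_measurable: "\<And>\<epsilon>. \<epsilon> \<in> {0<..1} \<Longrightarrow> \<psi> \<epsilon> \<in> borel_measurable lebesgue"
    and psi_integral: "\<And>\<epsilon>. \<epsilon> \<in> {0<..1} \<Longrightarrow> (LINT u|lebesgue. \<psi> \<epsilon> u) = 1"
    and psi_support: "hausdorff_tendsto (\<lambda>\<epsilon>. {u. \<psi> \<epsilon> u > 0}) {0} (at_right 0)"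
    and ct_eq: "\<And>z \<epsilon>. \<epsilon> \<in> {0<..1} \<Longrightarrow> ct z \<epsilon> = averaged c \<psi> z \<epsilon>"
  shows "smoothing_function X Y c ct \<and>
    (\<forall>x\<in>X. \<forall>y\<in>Y.
       sequential_limits (\<lambda>z \<epsilon>. gradient (\<lambda>z. ct z \<epsilon>) z) x y \<subseteq> clarke_subdiff c (x, y) \<and>
       sequential_limits (\<lambda>(x, y) \<epsilon>. gradient (\<lambda>x. ct (x, y) \<epsilon>) x) x y
         \<subseteq> clarke_subdiff (\<lambda>x. c (x, y)) x \<and>
       sequential_limits (\<lambda>(x, y) \<epsilon>. gradient (\<lambda>y. ct (x, y) \<epsilon>) y) x y
         \<subseteq> clarke_subdiff (\<lambda>y. c (x, y)) y) \<and>
    (\<forall>\<epsilon>\<in>{0<..1}. (\<forall>y. convex_on UNIV (\<lambda>x. ct (x, y) \<epsilon>)) \<and>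
                  (\<forall>x. concave_on UNIV (\<lambda>y. ct (x, y) \<epsilon>)))"
proof -
  obtain L where lip: "L-lipschitz_on UNIV c" using lipschitz by blast
  define M where "M \<epsilon> = density lebesgue (\<lambda>u. ennreal (\<psi> \<epsilon> u))" for \<epsilon>
  have "saddle_function c L"
    by (rule saddle_function.intro[OF lip convex_x concave_y])
  moreover have "shrinking_averages M"
  proof (rule shrinking_averages.intro)
    show "averaging (M \<epsilon>)" if "\<epsilon> \<in> {0<..1}" for \<epsilon>
      unfolding M_def using that by (intro averaging_density psi_measurable psi_nonneg psi_integral)
    fix \<delta> :: real assume "\<delta> > 0"
    then have "\<forall>\<^sub>F \<epsilon> in at_right 0. {u. \<psi> \<epsilon> u > 0} \<subseteq> ball 0 \<delta>"
      using psi_support unfolding hausdorff_tendsto_def by (force elim: eventually_mono)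
    moreover have "\<forall>\<^sub>F \<epsilon> in at_right (0::real). \<epsilon> \<in> {0<..<1}"
      by (rule eventually_at_right_real) simp
    ultimately show "\<forall>\<^sub>F \<epsilon> in at_right 0. AE u in M \<epsilon>. norm u < \<delta>"
    proof eventually_elim
      case (elim \<epsilon>)
      have "\<psi> \<epsilon> \<in> borel_measurable lebesgue" using elim by (intro psi_measurable) auto
      then show ?case
        unfolding M_def using elim(1) by (subst AE_density) (auto intro!: AE_I2)
    qed
  qed
  ultimately interpret saddle_averages c L M by (rule saddle_averages.intro)
  have ct: "(\<lambda>z. ct z \<epsilon>) = convolve (M \<epsilon>) c" if "\<epsilon> \<in> {0<..1}" for \<epsilon>
  proof
    fix z
    show "ct z \<epsilon> = convolve (M \<epsilon>) c z"
      unfolding M_def ct_eq[OF that] using that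
      by (intro averaged_eq_convolve lipschitz_on_continuous_on[OF lip] psi_measurable psi_nonneg)
  qed
  have ct': "ct z \<epsilon> = convolve (M \<epsilon>) c z" if "\<epsilon> \<in> {0<..1}" for z \<epsilon>
    using fun_cong[OF ct[OF that]] .
  have "smoothing_function X Y c ct"
  proof -
    have "((\<lambda>(z, \<epsilon>). ct z \<epsilon>) \<longlongrightarrow> c (x, y)) (at ((x, y), 0) within (X \<times> Y) \<times> {0<..1})"
      if "x \<in> X" "y \<in> Y" for x y
    proof (rule Lim_transform_within[OF _ zero_less_one])
      show "((\<lambda>(z, \<epsilon>). convolve (M \<epsilon>) c z) \<longlongrightarrow> c (x, y)) (at ((x, y), 0) within (X \<times> Y) \<times> {0<..1})"
        using smoothing[of X Y] that by (auto simp: smoothing_function_def)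
    qed (auto simp: ct')
    moreover have "cont_diff_on (X \<times> Y) (\<lambda>z. ct z \<epsilon>)" if "\<epsilon> \<in> {0<..1}" for \<epsilon>
      using smoothing[of X Y] that by (simp add: smoothing_function_def ct)
    ultimately show ?thesis by (simp add: smoothing_function_def)
  qed
  moreover have "sequential_limits (\<lambda>z \<epsilon>. gradient (\<lambda>z. ct z \<epsilon>) z) x y \<subseteq> clarke_subdiff c (x, y)" for x y
    unfolding sequential_limits_def
    by (clarsimp simp: ct simp del: greaterThanAtMost_iff) (rule full_gradient_limit; (assumption | erule spec))
  moreover have "sequential_limits (\<lambda>(x, y) \<epsilon>. gradient (\<lambda>x. ct (x, y) \<epsilon>) x) x y
      \<subseteq> clarke_subdiff (\<lambda>x. c (x, y)) x" for x y
    unfolding sequential_limits_def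
    by (clarsimp simp: ct' simp del: greaterThanAtMost_iff) (rule x_gradient_limit; (assumption | erule spec))
  moreover have "sequential_limits (\<lambda>(x, y) \<epsilon>. gradient (\<lambda>y. ct (x, y) \<epsilon>) y) x y
      \<subseteq> clarke_subdiff (\<lambda>y. c (x, y)) y" for x y
    unfolding sequential_limits_def
    by (clarsimp simp: ct' simp del: greaterThanAtMost_iff) (rule y_gradient_limit; (assumption | erule spec))
  moreover have "convex_on UNIV (\<lambda>x. ct (x, y) \<epsilon>)" "concave_on UNIV (\<lambda>y. ct (x, y) \<epsilon>)"
    if "\<epsilon> \<in> {0<..1}" for \<epsilon> x y
    using that by (simp_all only: ct' convex_average_x concave_average_y avg)
  ultimately show ?thesis by blast
qed

end
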